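(* Let $\mathfrak G$ be the Grigorchuk group, with generators $a,b,c,d$. The normal closure $\langle d\rangle^{\mathfrak G}$ of $d$ in $\mathfrak G$ is generated by the eight elements $$d,\ d^{a},\ d^{ac},\ d^{aca},\ d^{acac},\ d^{acaca},\ d^{acacac},\ d^{acacaca},$$ and no generating set of $\langle d\rangle^{\mathfrak G}$ has fewer than $8$ elements. In particular, $\langle d\rangle^{\mathfrak G}\neq\langle d,d^a,d^{ac},d^{aca}\rangle$.
   Context: Conjugation is written $x^y=y^{-1}xy$. The Grigorchuk group $\mathfrak G$ is given by the presentation with generators $a,b,c,d$ and relators $a^2,b^2,c^2,d^2,bcd$ together with all $((ad)^4)^{\sigma^n}$ and $((adacac)^4)^{\sigma^n}$ for $n\ge 0$, where $\sigma$ is the endomorphism of the free group on $\{a,b,c,d\}$ induced by $a\mapsto aca$, $b\mapsto d$, $c\mapsto b$, $d\mapsto c$ (Lys\"enok's presentation). *)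

theory Defs
  imports "HOL-Algebra.Generated_Groups" "HOL.Hull"
begin

text \<open>A letter \<open>(x, True)\<close> stands for the generator \<open>x\<close>, a letter \<open>(x, False)\<close> for its
  inverse. Elements of the free group are words up to insertion and deletion of
  cancelling pairs of letters.\<close>

type_synonym 'a word = "('a \<times> bool) list"

inductive cancels :: "'a word \<Rightarrow> 'a word \<Rightarrow> bool" where
  "cancels (u @ [(x, e), (x, \<not> e)] @ v) (u @ v)"

definition free_class :: "'a word \<Rightarrow> 'a word set" where
  "free_class w = {w'. equivclp cancels w w'}"

definition free_group :: "'a word set monoid" where
  "free_group = \<lparr>carrier = range free_class,
     mult = (\<lambda>X Y. \<Union>u\<in>X. \<Union>v\<in>Y. free_class (u @ v)),
     one = free_class []\<rparr>"

definition free_gen :: "'a \<Rightarrow> 'a word set" where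
  "free_gen x = free_class [(x, True)]"

fun word_eval :: "('g, 'm) monoid_scheme \<Rightarrow> ('a \<Rightarrow> 'g) \<Rightarrow> 'a word \<Rightarrow> 'g" where
  "word_eval G f [] = \<one>\<^bsub>G\<^esub>"
| "word_eval G f ((x, e) # w) = (if e then f x else inv\<^bsub>G\<^esub> f x) \<otimes>\<^bsub>G\<^esub> word_eval G f w"

text \<open>The homomorphism from the free group to \<open>G\<close> induced by \<open>f\<close>. The image of a class under
  \<open>word_eval G f\<close> is a singleton when \<open>G\<close> is a group and \<open>f\<close> maps into its carrier.\<close>

definition free_lift :: "('g, 'm) monoid_scheme \<Rightarrow> ('a \<Rightarrow> 'g) \<Rightarrow> 'a word set \<Rightarrow> 'g" where
  "free_lift G f X = the_elem (word_eval G f ` X)"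

lemma free_class_self: "w \<in> free_class w"
  by (simp add: free_class_def)

lemma free_class_eq_iff: "free_class u = free_class v \<longleftrightarrow> equivclp cancels u v"
proof
  assume eq: "free_class u = free_class v"
  have "v \<in> free_class u" by (simp only: eq free_class_self)
  then show "equivclp cancels u v" by (simp add: free_class_def)
next
  assume uv: "equivclp cancels u v"
  have "equivclp cancels u w \<longleftrightarrow> equivclp cancels v w" for w
    using equivclp_trans[OF uv, of w] equivclp_trans[OF equivclp_sym[OF uv], of w] by iprover
  then show "free_class u = free_class v" by (simp add: free_class_def)
qed

lemma cancels_cong: "cancels u v \<Longrightarrow> cancels (p @ u @ q) (p @ v @ q)"
proof (induction rule: cancels.induct)
  case (1 u x e v)
  show ?case using cancels.intros[of "p @ u" x e "v @ q"] by simp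
qed

lemma equivclp_cancels_cong1:
  "equivclp cancels u v \<Longrightarrow> equivclp cancels (p @ u @ q) (p @ v @ q)"
proof (induction rule: equivclp_induct)
  case base
  show ?case by simp
next
  case (step y z)
  have "cancels (p @ y @ q) (p @ z @ q) \<or> cancels (p @ z @ q) (p @ y @ q)"
    using step.hyps(2) by (elim disjE) (simp_all only: cancels_cong simp_thms)
  then have "equivclp cancels (p @ y @ q) (p @ z @ q)"
    by (elim disjE) (rule r_into_equivclp equivclp_sym[OF r_into_equivclp], assumption)+
  with step.IH show ?case by (rule equivclp_trans)
qed

lemma equivclp_cancels_append:
  assumes "equivclp cancels u u'" "equivclp cancels v v'"
  shows "equivclp cancels (u @ v) (u' @ v')"
proof (rule equivclp_trans)
  show "equivclp cancels (u @ v) (u' @ v)"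
    using equivclp_cancels_cong1[OF assms(1), of "[]" v] by simp
  show "equivclp cancels (u' @ v) (u' @ v')"
    using equivclp_cancels_cong1[OF assms(2), of u' "[]"] by simp
qed

lemma free_class_mult:
  "free_class u \<otimes>\<^bsub>free_group\<^esub> free_class v = free_class (u @ v)"
proof -
  have eq: "free_class (u' @ v') = free_class (u @ v)"
    if "u' \<in> free_class u" "v' \<in> free_class v" for u' v'
  proof -
    have "equivclp cancels u u'" "equivclp cancels v v'"
      using that by (simp_all add: free_class_def)
    then have "equivclp cancels (u @ v) (u' @ v')" by (rule equivclp_cancels_append)
    then show ?thesis unfolding free_class_eq_iff by (rule equivclp_sym)
  qed
  have ne: "free_class u \<noteq> {}" "free_class v \<noteq> {}"
    using free_class_self[of u] free_class_self[of v] by blast+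
  have "free_class u \<otimes>\<^bsub>free_group\<^esub> free_class v =
      (\<Union>u'\<in>free_class u. \<Union>v'\<in>free_class v. free_class (u' @ v'))"
    by (simp add: free_group_def)
  also have "\<dots> = (\<Union>u'\<in>free_class u. \<Union>v'\<in>free_class v. free_class (u @ v))"
    by (intro SUP_cong refl eq)
  also have "\<dots> = free_class (u @ v)"
    by (simp only: SUP_const[OF ne(1)] SUP_const[OF ne(2)])
  finally show ?thesis .
qed

lemma cancels_inverse_word:
  "equivclp cancels (map (\<lambda>(x, e). (x, \<not> e)) (rev w) @ w) []"
proof (induction w)
  case Nil
  show ?case by simp
next
  case (Cons l w)
  obtain x e where l: "l = (x, e)" by fastforce
  let ?r = "map (\<lambda>(x, e). (x, \<not> e)) (rev w)"
  have "cancels (?r @ [(x, \<not> e), (x, \<not> \<not> e)] @ w) (?r @ w)" by (rule cancels.intros)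
  then have "equivclp cancels (?r @ [(x, \<not> e), (x, e)] @ w) (?r @ w)"
    by (simp add: r_into_equivclp)
  from equivclp_trans[OF this Cons.IH] show ?case by (simp add: l)
qed

lemma group_free_group: "group free_group"
proof (rule groupI)
  fix x :: "'a word set"
  assume "x \<in> carrier free_group"
  then obtain w where w: "x = free_class w" by (auto simp: free_group_def)
  let ?y = "free_class (map (\<lambda>(x, e). (x, \<not> e)) (rev w))"
  have "?y \<otimes>\<^bsub>free_group\<^esub> x = \<one>\<^bsub>free_group\<^esub>"
    using cancels_inverse_word[of w]
    by (simp only: w free_class_mult) (simp add: free_group_def free_class_eq_iff)
  moreover have "?y \<in> carrier free_group" by (simp add: free_group_def)
  ultimately show "\<exists>y\<in>carrier free_group. y \<otimes>\<^bsub>free_group\<^esub> x = \<one>\<^bsub>free_group\<^esub>" by blast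
  have "free_class [] \<otimes>\<^bsub>free_group\<^esub> x = x" by (simp add: w free_class_mult)
  then show "\<one>\<^bsub>free_group\<^esub> \<otimes>\<^bsub>free_group\<^esub> x = x" by (simp add: free_group_def)
next
  show "\<one>\<^bsub>free_group\<^esub> \<in> carrier free_group" by (simp add: free_group_def)
next
  fix x y :: "'a word set"
  assume "x \<in> carrier free_group" "y \<in> carrier free_group"
  then obtain u v where "x = free_class u" "y = free_class v" by (auto simp: free_group_def)
  then have "x \<otimes>\<^bsub>free_group\<^esub> y = free_class (u @ v)" by (simp add: free_class_mult)
  then show "x \<otimes>\<^bsub>free_group\<^esub> y \<in> carrier free_group" by (simp add: free_group_def)
next
  fix x y z :: "'a word set"
  assume "x \<in> carrier free_group" "y \<in> carrier free_group" "z \<in> carrier free_group"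
  then obtain u v w where "x = free_class u" "y = free_class v" "z = free_class w"
    by (auto simp: free_group_def)
  then show "x \<otimes>\<^bsub>free_group\<^esub> y \<otimes>\<^bsub>free_group\<^esub> z = x \<otimes>\<^bsub>free_group\<^esub> (y \<otimes>\<^bsub>free_group\<^esub> z)"
    by (simp add: free_class_mult)
qed

lemma free_gen_closed: "free_gen x \<in> carrier free_group"
  by (simp add: free_gen_def free_group_def)

context group
begin

lemma word_eval_closed: "range f \<subseteq> carrier G \<Longrightarrow> word_eval G f w \<in> carrier G"
  by (induction w) (auto simp: image_subset_iff)

lemma word_eval_append:
  "range f \<subseteq> carrier G \<Longrightarrow> word_eval G f (u @ v) = word_eval G f u \<otimes> word_eval G f v"
proof (induction u)
  case Nil
  then show ?case by (simp add: word_eval_closed)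
next
  case (Cons l u)
  obtain x e where l: "l = (x, e)" by fastforce
  have "f x \<in> carrier G" using Cons.prems by auto
  then show ?case using Cons by (simp add: l m_assoc word_eval_closed)
qed

lemma word_eval_cancels:
  "cancels u v \<Longrightarrow> range f \<subseteq> carrier G \<Longrightarrow> word_eval G f u = word_eval G f v"
proof (induction rule: cancels.induct)
  case (1 u x e v)
  have "f x \<in> carrier G" using 1 by auto
  then have "word_eval G f ([(x, e), (x, \<not> e)] @ v) = word_eval G f v"
    using word_eval_closed[OF 1, of v] by (simp add: m_assoc[symmetric])
  then show ?case using 1 by (simp only: word_eval_append)
qed

lemma word_eval_equivclp:
  "equivclp cancels u v \<Longrightarrow> range f \<subseteq> carrier G \<Longrightarrow> word_eval G f u = word_eval G f v"
  by (induction rule: equivclp_induct) (metis word_eval_cancels)+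

lemma free_lift_class:
  assumes "range f \<subseteq> carrier G"
  shows "free_lift G f (free_class w) = word_eval G f w"
proof -
  have "word_eval G f ` free_class w = {word_eval G f w}"
    using word_eval_equivclp[OF _ assms, of w] by (force simp: free_class_def)
  then show ?thesis by (simp add: free_lift_def)
qed

lemma free_lift_gen:
  assumes "range f \<subseteq> carrier G"
  shows "free_lift G f (free_gen x) = f x"
proof -
  have "f x \<in> carrier G" using assms by auto
  then show ?thesis by (simp add: free_gen_def free_lift_class[OF assms])
qed

lemma free_lift_hom:
  fixes f :: "'x \<Rightarrow> 'a"
  assumes "range f \<subseteq> carrier G"
  shows "free_lift G f \<in> hom free_group G"
proof (rule homI)
  fix x :: "'x word set"
  assume "x \<in> carrier free_group"
  then show "free_lift G f x \<in> carrier G"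
    by (auto simp: free_group_def free_lift_class[OF assms] word_eval_closed[OF assms])
next
  fix x y :: "'x word set"
  assume "x \<in> carrier free_group" "y \<in> carrier free_group"
  then obtain u v where "x = free_class u" "y = free_class v" by (auto simp: free_group_def)
  then show "free_lift G f (x \<otimes>\<^bsub>free_group\<^esub> y) = free_lift G f x \<otimes> free_lift G f y"
    by (simp add: free_class_mult free_lift_class[OF assms] word_eval_append[OF assms])
qed

end

definition normal_closure :: "('g, 'm) monoid_scheme \<Rightarrow> 'g set \<Rightarrow> 'g set" where
  "normal_closure G S = (\<lambda>N. N \<lhd> G) hull S"

lemma (in group) normal_closure_normal:
  assumes "S \<subseteq> carrier G"
  shows "normal_closure G S \<lhd> G"
proof (rule normal_invI)
  have "carrier G \<lhd> G" by (rule normal_self)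
  then show "subgroup (normal_closure G S) G"
    unfolding normal_closure_def hull_def using assms
    by (intro subgroups_Inter) (auto dest: normal_imp_subgroup)
next
  fix g h
  assume "g \<in> carrier G" "h \<in> normal_closure G S"
  then show "g \<otimes> h \<otimes> inv g \<in> normal_closure G S"
    by (auto simp: normal_closure_def hull_def normal_inv_iff)
qed

definition presented_group :: "'a word set set \<Rightarrow> 'a word set set monoid" where
  "presented_group R = free_group Mod normal_closure free_group R"

definition presented_gen :: "'a word set set \<Rightarrow> 'a \<Rightarrow> 'a word set set" where
  "presented_gen R x = normal_closure free_group R #>\<^bsub>free_group\<^esub> free_gen x"

lemma group_presented_group:
  "R \<subseteq> carrier free_group \<Longrightarrow> group (presented_group R)"
  unfolding presented_group_def
  by (intro normal.factorgroup_is_group group.normal_closure_normal group_free_group)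

definition conjugate :: "('g, 'm) monoid_scheme \<Rightarrow> 'g \<Rightarrow> 'g \<Rightarrow> 'g" where
  "conjugate G x y = inv\<^bsub>G\<^esub> y \<otimes>\<^bsub>G\<^esub> x \<otimes>\<^bsub>G\<^esub> y"

datatype letter = A | B | C | D

fun lysenok_image :: "letter \<Rightarrow> letter word set" where
  "lysenok_image A = free_gen A \<otimes>\<^bsub>free_group\<^esub> free_gen C \<otimes>\<^bsub>free_group\<^esub> free_gen A"
| "lysenok_image B = free_gen D"
| "lysenok_image C = free_gen B"
| "lysenok_image D = free_gen C"

definition lysenok_sigma :: "letter word set \<Rightarrow> letter word set" where
  "lysenok_sigma = free_lift free_group lysenok_image"

lemma range_lysenok_image: "range lysenok_image \<subseteq> carrier free_group"
proof -
  interpret group "free_group :: letter word set monoid" by (rule group_free_group)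
  have "lysenok_image x \<in> carrier free_group" for x
    by (cases x) (auto simp: free_gen_closed)
  then show ?thesis by blast
qed

lemma lysenok_sigma_hom: "lysenok_sigma \<in> hom free_group free_group"
  unfolding lysenok_sigma_def
  by (rule group.free_lift_hom[OF group_free_group range_lysenok_image])

lemma lysenok_sigma_gen: "lysenok_sigma (free_gen x) = lysenok_image x"
  unfolding lysenok_sigma_def
  by (rule group.free_lift_gen[OF group_free_group range_lysenok_image])

definition grigorchuk_relators :: "letter word set set" where
  "grigorchuk_relators =
    (let F = free_group; a = free_gen A; b = free_gen B; c = free_gen C; d = free_gen D in
       {a [^]\<^bsub>F\<^esub> (2::nat), b [^]\<^bsub>F\<^esub> (2::nat), c [^]\<^bsub>F\<^esub> (2::nat), d [^]\<^bsub>F\<^esub> (2::nat),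
        b \<otimes>\<^bsub>F\<^esub> c \<otimes>\<^bsub>F\<^esub> d}
       \<union> range (\<lambda>n. (lysenok_sigma ^^ n) ((a \<otimes>\<^bsub>F\<^esub> d) [^]\<^bsub>F\<^esub> (4::nat)))
       \<union> range (\<lambda>n. (lysenok_sigma ^^ n)
           ((a \<otimes>\<^bsub>F\<^esub> d \<otimes>\<^bsub>F\<^esub> a \<otimes>\<^bsub>F\<^esub> c \<otimes>\<^bsub>F\<^esub> a \<otimes>\<^bsub>F\<^esub> c) [^]\<^bsub>F\<^esub> (4::nat))))"

definition grigorchuk_group :: "letter word set set monoid" where
  "grigorchuk_group = presented_group grigorchuk_relators"

definition grigorchuk_gen :: "letter \<Rightarrow> letter word set set" where
  "grigorchuk_gen = presented_gen grigorchuk_relators"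

lemma grigorchuk_relators_closed: "grigorchuk_relators \<subseteq> carrier free_group"
proof -
  interpret group "free_group :: letter word set monoid" by (rule group_free_group)
  have "(lysenok_sigma ^^ n) x \<in> carrier free_group" if "x \<in> carrier free_group" for n x
    using that by (induction n) (auto intro: hom_in_carrier[OF lysenok_sigma_hom])
  then show ?thesis
    unfolding grigorchuk_relators_def Let_def by (auto simp: free_gen_closed)
qed

lemma group_grigorchuk_group: "group grigorchuk_group"
  unfolding grigorchuk_group_def
  by (rule group_presented_group[OF grigorchuk_relators_closed])

end

theory Submission
  imports Defs "HOL-Algebra.Bij"
begin

text \<open>
  The elements \<open>a\<close> and \<open>c\<close> generate a dihedral group, in which \<open>(ac)\<^sup>8 = 1\<close> because
  \<open>((ad)\<^sup>4)\<^sup>\<sigma> = (acac)\<^sup>4\<close>. As \<open>c\<close> commutes with \<open>d\<close>, only eight conjugates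
  of \<open>d\<close> by elements of \<open>\<langle>a, c\<rangle>\<close> remain; they form a path along which \<open>a\<close> and \<open>c\<close> swap
  neighbours alternately, and so they generate a normal subgroup.

  For the lower bound, let \<open>a\<close> and \<open>c\<close> act on eight points by the two matchings of this path, and let
  \<open>d\<close> change the sign of the first point. These signed permutations satisfy all of Lysenok's relators,
  and the eight conjugates of \<open>d\<close> become the sign changes of single points. They generate an
  elementary abelian group of order \<open>2\<^sup>8\<close>, which cannot be generated by fewer than eight elements.
\<close>

section \<open>Generators of the normal closure\<close>

lemma normal_closure_superset: "S \<subseteq> normal_closure G S"
  by (simp add: normal_closure_def hull_subset)

lemma normal_closure_minimal: "S \<subseteq> N \<Longrightarrow> N \<lhd> G \<Longrightarrow> normal_closure G S \<subseteq> N"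
  by (simp add: normal_closure_def hull_minimal)

section \<open>Conjugation and a criterion for normality\<close>

context group
begin

lemma conjugate_closed [simp]:
  "x \<in> carrier G \<Longrightarrow> y \<in> carrier G \<Longrightarrow> conjugate G x y \<in> carrier G"
  by (simp add: conjugate_def)

lemma conjugate_conjugate:
  assumes "x \<in> carrier G" "y \<in> carrier G" "z \<in> carrier G"
  shows "conjugate G (conjugate G x y) z = conjugate G x (y \<otimes> z)"
  using assms by (simp add: conjugate_def m_assoc inv_mult_group)

lemma conjugate_mult:
  assumes "x \<in> carrier G" "x' \<in> carrier G" "y \<in> carrier G"
  shows "conjugate G (x \<otimes> x') y = conjugate G x y \<otimes> conjugate G x' y"
proof -
  have "y \<otimes> (inv y \<otimes> (x' \<otimes> y)) = x' \<otimes> y"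
    using assms by (simp add: m_assoc[symmetric])
  then show ?thesis
    using assms by (simp add: conjugate_def m_assoc)
qed

lemma conjugate_inv:
  assumes "x \<in> carrier G" "y \<in> carrier G"
  shows "conjugate G (inv x) y = inv (conjugate G x y)"
  using assms by (simp add: conjugate_def m_assoc inv_mult_group)

lemma conjugate_in_normal:
  assumes "N \<lhd> G" "x \<in> N" "y \<in> carrier G"
  shows "conjugate G x y \<in> N"
  using normal.inv_op_closed1[OF assms(1,3,2)] by (simp add: conjugate_def)

text \<open>Conjugation by a fixed element is a homomorphism, so invariance of
  \<open>generate G X\<close> under each \<open>t\<close> in \<open>T\<close> can be tested on
  \<open>X\<close>. It then passes to products of elements of \<open>T\<close>; since each
  \<open>t\<close> is its own inverse, such products already exhaust the group.\<close>

lemma generate_normal_if_involutions: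
  assumes X: "X \<subseteq> carrier G" and T: "T \<subseteq> carrier G" "carrier G = generate G T"
    and inv: "\<And>t. t \<in> T \<Longrightarrow> t \<otimes> t = \<one>"
    and conj: "\<And>x t. x \<in> X \<Longrightarrow> t \<in> T \<Longrightarrow> conjugate G x t \<in> generate G X"
  shows "generate G X \<lhd> G"
proof -
  have X': "h \<in> carrier G" if "h \<in> generate G X" for h
    using generate_in_carrier[OF X that] .
  have T': "conjugate G h t \<in> generate G X" if "h \<in> generate G X" "t \<in> T" for h t
  proof -
    have t: "t \<in> carrier G" using T that by blast
    show ?thesis using that(1)
    proof (induction rule: generate.induct)
      case one
      show ?case using t by (simp add: conjugate_def generate.one)
    next
      case (incl h)
      then show ?case using conj that(2) by blast
    next
      case (inv h)
      then show ?case
        using conj[OF inv that(2)] generate_m_inv_closed[OF X] X t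
        by (auto simp: conjugate_inv)
    next
      case (eng h1 h2)
      then show ?case using X' t by (simp add: conjugate_mult generate.eng)
    qed
  qed
  have all: "\<forall>h\<in>generate G X. conjugate G h g \<in> generate G X" if "g \<in> generate G T" for g
    using that
  proof (induction rule: generate.induct)
    case one
    show ?case using X' by (simp add: conjugate_def)
  next
    case (incl t)
    then show ?case using T' by blast
  next
    case (inv t)
    then have "inv t = t" using assms(4) T by (intro inv_equality) auto
    then show ?case using T' inv by simp
  next
    case (eng g1 g2)
    have "g1 \<in> carrier G" "g2 \<in> carrier G" using eng T by auto
    with eng show ?case using X' by (metis conjugate_conjugate)
  qed
  show ?thesis
  proof (rule normal_invI)
    show "subgroup (generate G X) G" by (rule generate_is_subgroup[OF X])
  next
    fix g h
    assume g: "g \<in> carrier G" and h: "h \<in> generate G X"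
    \<comment> \<open>\<open>conjugate\<close> puts the inverse on the left, whereas
      \<open>normal_invI\<close> asks for it on the right; hence the passage to
      \<open>inv g\<close>.\<close>
    have "inv g \<in> generate G T" using inv_closed[OF g] T(2) by (simp only:)
    with all h have "conjugate G h (inv g) \<in> generate G X" by blast
    then show "g \<otimes> h \<otimes> inv g \<in> generate G X" using g by (simp add: conjugate_def)
  qed
qed

section \<open>Alternating products of two involutions\<close>

primrec alternating :: "'a \<Rightarrow> 'a \<Rightarrow> nat \<Rightarrow> 'a" where
  "alternating a c 0 = \<one>"
| "alternating a c (Suc k) = alternating a c k \<otimes> (if even k then a else c)"

lemma alternating_closed [simp]:
  "a \<in> carrier G \<Longrightarrow> c \<in> carrier G \<Longrightarrow> alternating a c k \<in> carrier G"
  by (induction k) auto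

lemma alternating_Suc_left:
  assumes "a \<in> carrier G" "c \<in> carrier G"
  shows "alternating a c (Suc k) = a \<otimes> alternating c a k"
  using assms by (induction k) (auto simp: m_assoc)

lemma alternating_even:
  assumes "a \<in> carrier G" "c \<in> carrier G"
  shows "alternating a c (2 * n) = (a \<otimes> c) [^] n"
  using assms by (induction n) (auto simp: m_assoc)

text \<open>Repeating the last letter erases it; on conjugates of \<open>d\<close> this is the step
  back along the path.\<close>

lemma alternating_cancel:
  assumes "a \<in> carrier G" "c \<in> carrier G" "a \<otimes> a = \<one>" "c \<otimes> c = \<one>"
  shows "alternating a c (Suc k) \<otimes> (if even k then a else c) = alternating a c k"
  using assms by (simp add: m_assoc)

text \<open>The right side is the inverse of the left, because \<open>c \<otimes> a\<close> inverts
  \<open>a \<otimes> c\<close>; and the left side squares to one, hence is its own inverse.\<close>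

lemma pow_involutions_swap:
  assumes ac: "a \<in> carrier G" "c \<in> carrier G" "a \<otimes> a = \<one>" "c \<otimes> c = \<one>"
    and ord: "(a \<otimes> c) [^] (2 * n) = \<one>"
  shows "(a \<otimes> c) [^] (n::nat) = (c \<otimes> a) [^] n"
proof -
  have "inv a = a" "inv c = c" using ac by (auto intro: inv_equality)
  then have "inv (a \<otimes> c) = c \<otimes> a" using ac by (simp add: inv_mult_group)
  moreover have "(a \<otimes> c) [^] n \<otimes> (a \<otimes> c) [^] n = \<one>"
    using ord ac by (simp add: nat_pow_mult mult_2)
  then have "inv ((a \<otimes> c) [^] n) = (a \<otimes> c) [^] n"
    using ac by (intro inv_equality) auto
  ultimately show ?thesis using nat_pow_inv[of "a \<otimes> c" n] ac by simp
qed

text \<open>Write \<open>x k\<close> for the conjugate of \<open>d\<close> by the alternating word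
  of length \<open>k\<close>. Appending a letter to the word conjugates once more, so
  \<open>a\<close> exchanges \<open>x 0, x 1\<close>, then \<open>x 2, x 3\<close>, and so on, while
  \<open>c\<close> exchanges \<open>x 1, x 2\<close>, then \<open>x 3, x 4\<close>, then
  \<open>x 5, x 6\<close>, and fixes both ends \<open>x 0\<close> and \<open>x 7\<close>. Thus the
  criterion for normality applies.\<close>

lemma normal_closure_eq_generate_conjugates:
  assumes closed: "a \<in> carrier G" "c \<in> carrier G" "d \<in> carrier G"
    and inv: "a \<otimes> a = \<one>" "c \<otimes> c = \<one>" "d \<otimes> d = \<one>"
    and comm: "c \<otimes> d = d \<otimes> c"
    and ord: "(a \<otimes> c) [^] (8::nat) = \<one>"
    and gen: "carrier G = generate G {a, c, d}"
  shows "normal_closure G {d} = generate G ((\<lambda>k. conjugate G d (alternating a c k)) ` {..<8})"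
    (is "_ = generate G (?x ` _)")
proof
  have X: "?x ` {..<8} \<subseteq> carrier G" using closed by auto
  have invc: "inv c = c" using closed inv by (intro inv_equality)
  have dc: "conjugate G d c = d"
    using closed inv by (simp add: conjugate_def invc comm m_assoc)
  have mem: "?x k \<in> generate G (?x ` {..<8})" if "k < 8" for k
    using that by (intro generate.incl) auto
  have d: "?x 0 = d" using closed by (simp add: conjugate_def)
  have step: "conjugate G (?x k) t = conjugate G d (alternating a c k \<otimes> t)"
    if "t \<in> carrier G" for k t
    using closed that by (simp add: conjugate_conjugate)
  have xa: "conjugate G (?x k) a \<in> generate G (?x ` {..<8})" if "k < 8" for k
  proof (cases "even k")
    case True
    then have "Suc k < 8" using that by presburger
    then show ?thesis
      using mem[of "Suc k"] True closed by (simp add: step)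
  next
    case False
    then obtain j where j: "k = Suc j" "even j" using odd_Suc_minus_one by (cases k) auto
    then have "conjugate G (?x k) a = ?x j"
      using closed inv alternating_cancel[of a c j] by (simp only: step) simp
    then show ?thesis using mem[of j] j that by simp
  qed
  have xc: "conjugate G (?x k) c \<in> generate G (?x ` {..<8})" if "k < 8" for k
  proof -
    consider "k = 0" | "k \<noteq> 0" "even k" | "k \<noteq> 7" "odd k" | "k = 7"
      by blast
    then show ?thesis
    proof cases
      case 1
      then show ?thesis using mem[of 0] d dc by simp
    next
      case 2
      then obtain j where j: "k = Suc j" "odd j" by (cases k) auto
      then have "conjugate G (?x k) c = ?x j"
        using closed inv alternating_cancel[of a c j] by (simp only: step) simp
      then show ?thesis using mem[of j] j that by simp
    next
      case 3
      then have "Suc k < 8" using that by simp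
      then show ?thesis
        using mem[of "Suc k"] 3 closed by (simp add: step)
    next
      case 4
      \<comment> \<open>The far end: as \<open>(ac)^4 = (ca)^4\<close>, the letter \<open>c\<close>
        can be moved from the right of the word of length 7 to its left, where it meets
        \<open>d\<close> and is absorbed by \<open>dc\<close>.\<close>
      have "alternating a c 7 \<otimes> c = alternating a c (2 * 4)"
        using alternating.simps(2)[of a c 7] by simp
      also have "\<dots> = alternating c a (2 * 4)"
        using pow_involutions_swap[of a c 4] closed inv ord by (simp only: alternating_even) simp
      also have "\<dots> = c \<otimes> alternating a c 7"
        using alternating_Suc_left[of c a 7] closed by simp
      finally have "conjugate G (?x 7) c = conjugate G (conjugate G d c) (alternating a c 7)"
        using closed by (simp add: step conjugate_conjugate)
      then show ?thesis using mem[of 7] dc 4 by simp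
    qed
  qed
  have "generate G (?x ` {..<8}) \<lhd> G"
  proof (rule generate_normal_if_involutions[OF X _ gen])
    fix x t
    assume x: "x \<in> ?x ` {..<8}" and t: "t \<in> {a, c, d}"
    \<comment> \<open>Conjugation by \<open>d\<close> is inner for the generated subgroup, which
      contains \<open>d\<close> as the conjugate with \<open>k = 0\<close>.\<close>
    have "d \<in> generate G (?x ` {..<8})" using mem[of 0] d by simp
    with generate.incl[OF x, of G] have "conjugate G x d \<in> generate G (?x ` {..<8})"
      unfolding conjugate_def[of G x d] by (intro generate.eng generate_m_inv_closed[OF X])
    then show "conjugate G x t \<in> generate G (?x ` {..<8})" using x t xa xc by auto
  qed (use closed inv in auto)
  moreover have "{d} \<subseteq> generate G (?x ` {..<8})" using mem[of 0] d by simp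
  ultimately show "normal_closure G {d} \<subseteq> generate G (?x ` {..<8})"
    by (rule normal_closure_minimal[rotated])
  have N: "normal_closure G {d} \<lhd> G" using closed by (intro normal_closure_normal) simp
  have "?x ` {..<8} \<subseteq> normal_closure G {d}"
    using closed normal_closure_superset[of "{d}" G] by (auto intro: conjugate_in_normal[OF N])
  then show "generate G (?x ` {..<8}) \<subseteq> normal_closure G {d}"
    by (rule generate_subgroup_incl[OF _ normal_imp_subgroup[OF N]])
qed

text \<open>Adding an involution \<open>s\<close> that commutes with the subgroup \<open>H\<close>
  generated so far yields at most the two cosets \<open>H\<close> and \<open>sH\<close>, so each new
  generator at most doubles the order.\<close>

lemma card_generate_commuting_involutions:
  assumes "finite S" "S \<subseteq> carrier G" "\<And>x. x \<in> S \<Longrightarrow> x \<otimes> x = \<one>"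
    and "\<And>x y. x \<in> S \<Longrightarrow> y \<in> S \<Longrightarrow> x \<otimes> y = y \<otimes> x"
  shows "finite (generate G S) \<and> card (generate G S) \<le> 2 ^ card S"
  using assms
proof (induction S)
  case empty
  then show ?case by (simp add: generate_empty)
next
  case (insert s S)
  let ?H = "generate G S"
  have s: "s \<in> carrier G" "s \<otimes> s = \<one>" and S: "S \<subseteq> carrier G" using insert.prems by auto
  have IH: "finite ?H" "card ?H \<le> 2 ^ card S" using insert by auto
  have H: "u \<in> carrier G" if "u \<in> ?H" for u using generate_in_carrier[OF S that] .
  have comm: "u \<otimes> s = s \<otimes> u" if "u \<in> ?H" for u
    using that
  proof (induction rule: generate.induct)
    case one
    then show ?case using s by simp
  next
    case (incl u)
    then show ?case using insert.prems(3) by blast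
  next
    case (inv u)
    then have "u \<in> carrier G" "u \<otimes> u = \<one>" using insert.prems(1,2) by auto
    then have "inv u = u" by (intro inv_equality)
    then show ?case using insert.prems(3) inv by auto
  next
    case (eng u v)
    then show ?case using s H by (metis m_assoc)
  qed
  have "generate G (insert s S) \<subseteq> ?H \<union> (\<lambda>u. s \<otimes> u) ` ?H"
  proof
    fix x
    assume "x \<in> generate G (insert s S)"
    then show "x \<in> ?H \<union> (\<lambda>u. s \<otimes> u) ` ?H"
    proof (induction rule: generate.induct)
      case one
      show ?case by (simp add: generate.one)
    next
      case (incl x)
      then show ?case using s generate.one[of G S] by (auto intro: generate.incl image_eqI[of _ _ \<one>])
    next
      case (inv x)
      have "inv s = s" using s by (intro inv_equality)
      then show ?case using s generate.one[of G S] inv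
        by (auto intro: generate.inv image_eqI[of _ _ \<one>])
    next
      case (eng x y)
      \<comment> \<open>These rules gather \<open>s\<close> at the front and cancel its square, so
        \<open>H\<close> together with \<open>sH\<close> is closed under products.\<close>
      have ss: "s \<otimes> u \<otimes> (s \<otimes> v) = u \<otimes> v" "u \<otimes> (s \<otimes> v) = s \<otimes> (u \<otimes> v)"
        "s \<otimes> u \<otimes> v = s \<otimes> (u \<otimes> v)"
        if "u \<in> ?H" "v \<in> ?H" for u v
      proof -
        have uv: "u \<in> carrier G" "v \<in> carrier G" using that H by auto
        have "u \<otimes> (s \<otimes> v) = (u \<otimes> s) \<otimes> v" using uv s by (simp add: m_assoc)
        then show 1: "u \<otimes> (s \<otimes> v) = s \<otimes> (u \<otimes> v)"
          using uv s by (simp add: comm that m_assoc)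
        show "s \<otimes> u \<otimes> v = s \<otimes> (u \<otimes> v)" using uv s by (simp add: m_assoc)
        have "s \<otimes> u \<otimes> (s \<otimes> v) = s \<otimes> (s \<otimes> (u \<otimes> v))" using uv s by (simp add: m_assoc 1)
        also have "\<dots> = s \<otimes> s \<otimes> (u \<otimes> v)" using uv s(1) by (simp add: m_assoc)
        finally show "s \<otimes> u \<otimes> (s \<otimes> v) = u \<otimes> v" using uv s by simp
      qed
      from eng.IH show ?case
        by (elim UnE imageE) (auto simp: ss intro: generate.eng)
    qed
  qed
  then have "finite (generate G (insert s S))"
    "card (generate G (insert s S)) \<le> card (?H \<union> (\<lambda>u. s \<otimes> u) ` ?H)"
    using IH by (auto intro: finite_subset card_mono)
  moreover have "card (?H \<union> (\<lambda>u. s \<otimes> u) ` ?H) \<le> card ?H + card ?H"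
    using card_Un_le[of ?H "(\<lambda>u. s \<otimes> u) ` ?H"] card_image_le[OF IH(1), of "\<lambda>u. s \<otimes> u"] by linarith
  ultimately show ?case using IH insert.hyps by simp
qed

end

section \<open>Presented groups\<close>

lemma (in group) normal_closure_subset_kernel:
  assumes "group_hom G H h" "S \<subseteq> kernel G H h"
  shows "normal_closure G S \<subseteq> kernel G H h"
  using assms by (intro normal_closure_minimal group_hom.normal_kernel)

lemma presented_gen_closed:
  "R \<subseteq> carrier free_group \<Longrightarrow> presented_gen R x \<in> carrier (presented_group R)"
  unfolding presented_gen_def presented_group_def carrier_FactGroup
  by (rule imageI[OF free_gen_closed])

lemma presented_projection_hom:
  assumes "R \<subseteq> carrier free_group"
  shows "(\<lambda>x. normal_closure free_group R #>\<^bsub>free_group\<^esub> x) \<in> hom free_group (presented_group R)"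
  unfolding presented_group_def
  by (intro normal.r_coset_hom_Mod group.normal_closure_normal group_free_group assms)

lemma presented_projection_relator:
  fixes R :: "'a word set set"
  assumes "R \<subseteq> carrier free_group" "r \<in> R"
  shows "normal_closure free_group R #>\<^bsub>free_group\<^esub> r = \<one>\<^bsub>presented_group R\<^esub>"
proof -
  interpret F: group "free_group :: 'a word set monoid" by (rule group_free_group)
  have "subgroup (normal_closure free_group R) free_group"
    using F.normal_closure_normal[OF assms(1)] by (rule normal_imp_subgroup)
  moreover have "r \<in> normal_closure free_group R"
    by (rule subsetD[OF normal_closure_superset assms(2)])
  ultimately show ?thesis
    using assms by (simp add: presented_group_def F.coset_join2 subsetD)
qed

lemma free_class_in_generate: "free_class w \<in> generate free_group (range free_gen)"
proof (induction w)
  case Nil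
  show ?case using generate.one[of free_group] by (simp add: free_group_def)
next
  case (Cons l w)
  interpret F: group "free_group :: 'a word set monoid" by (rule group_free_group)
  obtain x e where l: "l = (x, e)" by fastforce
  have "free_class [(x, False)] \<otimes>\<^bsub>free_group\<^esub> free_gen x = \<one>\<^bsub>free_group\<^esub>"
    using cancels_inverse_word[of "[(x, True)]"]
    by (simp add: free_gen_def free_class_mult) (simp add: free_group_def free_class_eq_iff)
  then have "inv\<^bsub>free_group\<^esub> free_gen x = free_class [(x, False)]"
    by (intro F.inv_equality free_gen_closed) (simp_all add: free_group_def)
  then have "free_class [(x, e)] \<in> generate free_group (range free_gen)"
    using generate.inv[of "free_gen x" "range free_gen" free_group]
      generate.incl[of "free_gen x" "range free_gen" free_group]
    by (cases e) (auto simp: free_gen_def)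
  then have "free_class [(x, e)] \<otimes>\<^bsub>free_group\<^esub> free_class w \<in> generate free_group (range free_gen)"
    using Cons.IH by (rule generate.eng)
  then show ?case by (simp add: l free_class_mult)
qed

lemma carrier_free_group: "carrier free_group = generate free_group (range free_gen)"
proof
  show "carrier free_group \<subseteq> generate free_group (range (free_gen :: 'a \<Rightarrow> _))"
    using free_class_in_generate by (auto simp: free_group_def)
  show "generate free_group (range (free_gen :: 'a \<Rightarrow> _)) \<subseteq> carrier free_group"
    by (rule group.generate_incl[OF group_free_group]) (auto simp: free_gen_closed)
qed

lemma carrier_presented_group:
  fixes R :: "'a word set set"
  assumes "R \<subseteq> carrier free_group"
  shows "carrier (presented_group R) = generate (presented_group R) (range (presented_gen R))"
proof -
  let ?p = "\<lambda>x. normal_closure free_group R #>\<^bsub>free_group\<^esub> x"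
  interpret p: group_hom free_group "presented_group R" ?p
    by (intro group_hom.intro group_hom_axioms.intro group_free_group
        group_presented_group presented_projection_hom assms)
  have "carrier (presented_group R) = ?p ` carrier free_group"
    by (simp add: presented_group_def carrier_FactGroup)
  also have "\<dots> = generate (presented_group R) (?p ` range free_gen)"
    unfolding carrier_free_group by (rule p.generate_img[symmetric]) (auto simp: free_gen_closed)
  also have "?p ` range free_gen = range (presented_gen R)"
    by (auto simp: presented_gen_def)
  finally show ?thesis .
qed

text \<open>Von Dyck's theorem: the kernel of the map from the free group is normal and contains the
  relators, hence their normal closure, so the map factors through the quotient.\<close>

lemma presented_group_lift:
  fixes H (structure) and f :: "'a \<Rightarrow> _"
  assumes H: "group H" and R: "R \<subseteq> carrier free_group" and f: "range f \<subseteq> carrier H"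
    and rel: "\<And>r. r \<in> R \<Longrightarrow> free_lift H f r = \<one>"
  obtains h where "h \<in> hom (presented_group R) H" "\<And>x. h (presented_gen R x) = f x"
proof -
  interpret group H by (rule H)
  interpret l: group_hom free_group H "free_lift H f"
    by (intro group_hom.intro group_hom_axioms.intro group_free_group H free_lift_hom f)
  have "R \<subseteq> kernel free_group H (free_lift H f)"
    using R rel by (auto simp: kernel_def)
  then have "normal_closure free_group R \<subseteq> kernel free_group H (free_lift H f)"
    by (intro group.normal_closure_subset_kernel group_free_group l.group_hom_axioms)
  with group.normal_closure_normal[OF group_free_group R] obtain h where "h \<in> hom (free_group Mod normal_closure free_group R) H"
    "\<And>x. x \<in> carrier free_group \<Longrightarrow>
      h (normal_closure free_group R #>\<^bsub>free_group\<^esub> x) = free_lift H f x"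
    by (rule l.FactGroup_universal_kernel) blast
  then show thesis
    using that by (simp add: presented_group_def presented_gen_def free_gen_closed free_lift_gen[OF f])
qed

section \<open>Signed permutations\<close>

text \<open>On a whole type the extensionality condition in \<open>BijGroup\<close> is vacuous, so
  its operations become ordinary composition and iteration.\<close>

lemma carrier_BijGroup_UNIV: "carrier (BijGroup UNIV) = {f. bij f}"
  by (simp add: BijGroup_def Bij_def extensional_def)

lemma mult_BijGroup_UNIV: "bij f \<Longrightarrow> bij g \<Longrightarrow> f \<otimes>\<^bsub>BijGroup UNIV\<^esub> g = f \<circ> g"
  by (simp add: BijGroup_def Bij_def extensional_def compose_def fun_eq_iff)

lemma one_BijGroup_UNIV: "\<one>\<^bsub>BijGroup UNIV\<^esub> = id"
  by (simp add: BijGroup_def fun_eq_iff)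

lemma pow_BijGroup_UNIV:
  assumes "bij f"
  shows "f [^]\<^bsub>BijGroup UNIV\<^esub> (n::nat) = f ^^ n"
proof -
  interpret group "BijGroup (UNIV :: 'a set)" by (rule group_BijGroup)
  show ?thesis
    by (induction n) (simp_all add: one_BijGroup_UNIV mult_BijGroup_UNIV assms bij_fn
        funpow_Suc_right del: funpow.simps(2))
qed

text \<open>A pair \<open>(i, s)\<close> is the point \<open>i\<close> with the sign \<open>s\<close>; only the points \<open>i < 8\<close> matter.\<close>

definition flip :: "nat set \<Rightarrow> nat \<times> bool \<Rightarrow> nat \<times> bool" where
  "flip Z = (\<lambda>(i, s). (i, s \<noteq> (i \<in> Z)))"

text \<open>The sign changes thus form a copy of the sets of points under symmetric difference, a
  vector space over the field with two elements.\<close>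

lemma flip_comp: "flip Z \<circ> flip Z' = flip (sym_diff Z Z')"
  by (auto simp: flip_def fun_eq_iff)

lemma flip_empty: "flip {} = id"
  by (simp add: flip_def fun_eq_iff)

lemma inj_flip: "inj flip"
  by (rule injI) (auto simp: flip_def fun_eq_iff)

lemma bij_flip: "bij (flip Z)"
  by (rule o_bij[of "flip Z"]) (simp_all add: flip_comp flip_empty)

definition swap_even :: "nat \<Rightarrow> nat" where
  "swap_even i = (if 8 \<le> i then i else if even i then i + 1 else i - 1)"

text \<open>The edges of the path 0, ..., 7 missing from \<open>swap_even\<close>. Both endpoints
  stay fixed, mirroring that \<open>c\<close> fixes the first and the last conjugate of
  \<open>d\<close>.\<close>

definition swap_odd :: "nat \<Rightarrow> nat" where
  "swap_odd i = (if i = 0 \<or> 7 \<le> i then i else if odd i then i + 1 else i - 1)"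

lemma swap_even_invol: "swap_even (swap_even i) = i"
  by (auto simp: swap_even_def elim!: evenE oddE)

lemma swap_odd_invol: "swap_odd (swap_odd i) = i"
  by (auto simp: swap_odd_def elim!: evenE oddE)

lemma flip_conjugate:
  assumes "\<And>i. p (p i) = i" "p k = l"
  shows "map_prod p id \<circ> flip {k} \<circ> map_prod p id = flip {l}"
  using assms by (auto simp: flip_def fun_eq_iff)

definition perm_a :: "nat \<times> bool \<Rightarrow> nat \<times> bool" where
  "perm_a = map_prod swap_even id"

definition perm_c :: "nat \<times> bool \<Rightarrow> nat \<times> bool" where
  "perm_c = map_prod swap_odd id"

definition perm_d :: "nat \<times> bool \<Rightarrow> nat \<times> bool" where
  "perm_d = flip {0}"

text \<open>The relator \<open>bcd\<close> forces this choice once \<open>c\<close> and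
  \<open>d\<close> are commuting involutions; they commute because \<open>perm_c\<close> fixes the
  point 0.\<close>

definition perm_b :: "nat \<times> bool \<Rightarrow> nat \<times> bool" where
  "perm_b = perm_c \<circ> perm_d"

lemma perm_a_simps:
  "perm_a (0, s) = (Suc 0, s)" "perm_a (Suc 0, s) = (0, s)" "perm_a (2, s) = (3, s)"
  "perm_a (3, s) = (2, s)" "perm_a (4, s) = (5, s)" "perm_a (5, s) = (4, s)"
  "perm_a (6, s) = (7, s)" "perm_a (7, s) = (6, s)" "8 \<le> i \<Longrightarrow> perm_a (i, s) = (i, s)"
  by (simp_all add: perm_a_def swap_even_def)

lemma perm_c_simps:
  "perm_c (0, s) = (0, s)" "perm_c (Suc 0, s) = (2, s)" "perm_c (2, s) = (Suc 0, s)"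
  "perm_c (3, s) = (4, s)" "perm_c (4, s) = (3, s)" "perm_c (5, s) = (6, s)"
  "perm_c (6, s) = (5, s)" "perm_c (7, s) = (7, s)" "8 \<le> i \<Longrightarrow> perm_c (i, s) = (i, s)"
  by (simp_all add: perm_c_def swap_odd_def)

lemma perm_d_simps: "perm_d (0, s) = (0, \<not> s)" "0 < i \<Longrightarrow> perm_d (i, s) = (i, s)"
  by (simp_all add: perm_d_def flip_def)

lemma flip_7_simps: "flip {7} (7, s) = (7, \<not> s)" "i \<noteq> 7 \<Longrightarrow> flip {7} (i, s) = (i, s)"
  by (simp_all add: flip_def)

text \<open>Reduces an identity between the permutations to eight explicit points, with arbitrary
  sign, and the remaining points, so that simplification can check it.\<close>

lemma perm_eqI:
  fixes f g :: "nat \<times> bool \<Rightarrow> 'a"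
  assumes "\<And>s. f (0, s) = g (0, s)" "\<And>s. f (Suc 0, s) = g (Suc 0, s)"
    "\<And>s. f (2, s) = g (2, s)" "\<And>s. f (3, s) = g (3, s)" "\<And>s. f (4, s) = g (4, s)"
    "\<And>s. f (5, s) = g (5, s)" "\<And>s. f (6, s) = g (6, s)" "\<And>s. f (7, s) = g (7, s)"
    "\<And>i s. 8 \<le> i \<Longrightarrow> f (i, s) = g (i, s)"
  shows "f = g"
proof
  fix x :: "nat \<times> bool"
  obtain i s where x: "x = (i, s)" by fastforce
  consider "i = 0" | "i = Suc 0" | "i = 2" | "i = 3" | "i = 4" | "i = 5" | "i = 6" | "i = 7" | "8 \<le> i"
    by linarith
  then show "f x = g x" unfolding x by cases (simp_all only: assms)
qed

lemmas perm_simps = perm_b_def perm_a_simps perm_c_simps perm_d_simps flip_7_simps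

section \<open>The relators along the orbit of the endomorphism\<close>

lemma funpow_4: "f ^^ 4 = f \<circ> f \<circ> f \<circ> f"
  by (simp add: numeral_eq_Suc comp_assoc)

lemma perm_invol:
  "perm_a \<circ> perm_a = id" "perm_b \<circ> perm_b = id" "perm_c \<circ> perm_c = id" "perm_d \<circ> perm_d = id"
  "perm_b \<circ> perm_c \<circ> perm_d = id"
  by (rule perm_eqI; simp add: perm_simps)+

lemma bij_perm: "bij perm_a" "bij perm_b" "bij perm_c" "bij perm_d"
  using perm_invol by (auto intro: o_bij)

text \<open>The actions of the first two iterated images of \<open>a\<close>: the endomorphism sends
  \<open>a\<close> to \<open>aca\<close>, and then \<open>aca\<close> to
  \<open>(aca)b(aca)\<close>.\<close>

definition perm_x1 where "perm_x1 = perm_a \<circ> perm_c \<circ> perm_a"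
definition perm_x2 where "perm_x2 = perm_x1 \<circ> perm_b \<circ> perm_x1"

text \<open>The third image of \<open>a\<close> acts as the sign change at the far end of the path,
  which commutes with \<open>perm_c\<close> because the point 7 is fixed there. From then on the
  image of \<open>a\<close> is conjugated by a permutation commuting with the one in its middle,
  which makes the orbit periodic.\<close>

lemma perm_recursion:
  "perm_x2 \<circ> perm_d \<circ> perm_x2 = flip {7}"
  "flip {7} \<circ> perm_c \<circ> flip {7} = perm_c" "perm_c \<circ> perm_b \<circ> perm_c = perm_b"
  "perm_b \<circ> perm_d \<circ> perm_b = perm_d" "perm_d \<circ> perm_c \<circ> perm_d = perm_c"
  by (rule perm_eqI; simp add: perm_simps perm_x1_def perm_x2_def)+

text \<open>The two base words of the infinite families, evaluated at a quadruple of images of the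
  generators. Both families then amount to this condition along the orbit of the quadruple.\<close>

definition relators_hold :: "('a \<Rightarrow> 'a) \<times> ('a \<Rightarrow> 'a) \<times> ('a \<Rightarrow> 'a) \<times> ('a \<Rightarrow> 'a) \<Rightarrow> bool" where
  "relators_hold = (\<lambda>(a, b, c, d). bij a \<and> bij b \<and> bij c \<and> bij d \<and>
     (a \<circ> d) ^^ 4 = id \<and> (a \<circ> d \<circ> a \<circ> c \<circ> a \<circ> c) ^^ 4 = id)"

text \<open>The images of \<open>(a, b, c, d)\<close> under \<open>\<sigma>\<^sup>n\<close>: the first four entries are \<open>n = 0, 1, 2, 3\<close>, and from
  \<open>n = 4\<close> on the last three recur with period 3.\<close>

lemma relators_hold_states:
  "relators_hold (perm_a, perm_b, perm_c, perm_d)"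
  "relators_hold (perm_x1, perm_d, perm_b, perm_c)"
  "relators_hold (perm_x2, perm_c, perm_d, perm_b)"
  "relators_hold (flip {7}, perm_b, perm_c, perm_d)"
  "relators_hold (perm_c, perm_d, perm_b, perm_c)"
  "relators_hold (perm_b, perm_c, perm_d, perm_b)"
  "relators_hold (perm_d, perm_b, perm_c, perm_d)"
  unfolding relators_hold_def split funpow_4
  by (intro conjI bij_perm bij_flip, (simp add: perm_x1_def perm_x2_def bij_comp bij_perm; fail)?;
     (rule perm_eqI; simp add: perm_simps perm_x1_def perm_x2_def))+

fun perm :: "letter \<Rightarrow> nat \<times> bool \<Rightarrow> nat \<times> bool" where
  "perm A = perm_a" | "perm B = perm_b" | "perm C = perm_c" | "perm D = perm_d"

lemma bij_letter_perm: "bij (perm x)"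
  by (cases x) (simp_all add: bij_perm)

text \<open>Evaluation after \<open>n\<close> applications of the endomorphism is a homomorphism on
  the free group, determined by four images. This quadruple evolves by a fixed rule through finitely
  many states, so infinitely many relators reduce to finitely many checks.\<close>

lemma perm_sigma_relators:
  fixes n :: nat
  defines "Q \<equiv> BijGroup (UNIV :: (nat \<times> bool) set)"
    and "F \<equiv> free_group :: letter word set monoid"
  defines "h \<equiv> \<lambda>x. free_lift Q perm ((lysenok_sigma ^^ n) x)"
  shows "h ((free_gen A \<otimes>\<^bsub>F\<^esub> free_gen D) [^]\<^bsub>F\<^esub> (4::nat)) = \<one>\<^bsub>Q\<^esub>"
    and "h ((free_gen A \<otimes>\<^bsub>F\<^esub> free_gen D \<otimes>\<^bsub>F\<^esub> free_gen A \<otimes>\<^bsub>F\<^esub> free_gen C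
           \<otimes>\<^bsub>F\<^esub> free_gen A \<otimes>\<^bsub>F\<^esub> free_gen C) [^]\<^bsub>F\<^esub> (4::nat)) = \<one>\<^bsub>Q\<^esub>"
proof -
  interpret Q: group Q unfolding Q_def by (rule group_BijGroup)
  interpret F: group F unfolding F_def by (rule group_free_group)
  define \<theta> where "\<theta> m x = free_lift Q perm ((lysenok_sigma ^^ m) x)" for m x
  have range_perm: "range perm \<subseteq> carrier Q"
    by (auto simp: Q_def carrier_BijGroup_UNIV bij_letter_perm)
  have \<theta>_0: "\<theta> 0 = free_lift Q perm" by (simp add: \<theta>_def fun_eq_iff)
  \<comment> \<open>The new application is made innermost, so the next quadruple arises by
    substituting the current one into the images \<open>aca\<close>, \<open>d\<close>,
    \<open>b\<close>, \<open>c\<close>.\<close>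
  have \<theta>_Suc: "\<theta> (Suc m) x = \<theta> m (lysenok_sigma x)" for m x
    by (simp only: \<theta>_def funpow_Suc_right comp_apply)
  have hom: "\<theta> m \<in> hom F Q" for m
  proof (induction m)
    case 0
    show ?case unfolding \<theta>_0 F_def by (rule Q.free_lift_hom[OF range_perm])
  next
    case (Suc m)
    have "\<theta> (Suc m) = \<theta> m \<circ> lysenok_sigma" by (simp add: fun_eq_iff \<theta>_Suc)
    then show ?case
      unfolding F_def using hom_compose[OF lysenok_sigma_hom Suc.IH[unfolded F_def]] by (simp only:)
  qed
  have gen: "free_gen x \<in> carrier F" for x by (simp add: F_def free_gen_closed)
  define q where "q m = (\<theta> m (free_gen A), \<theta> m (free_gen B), \<theta> m (free_gen C), \<theta> m (free_gen D))" for m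
  have bij: "bij (\<theta> m (free_gen x))" for m x
    using hom_in_carrier[OF hom gen] by (simp add: Q_def carrier_BijGroup_UNIV)
  have q_Suc: "q (Suc m) = (case q m of (a, b, c, d) \<Rightarrow> (a \<circ> c \<circ> a, d, b, c))" for m
  proof -
    have "\<theta> m (free_gen A \<otimes>\<^bsub>F\<^esub> free_gen C \<otimes>\<^bsub>F\<^esub> free_gen A)
        = \<theta> m (free_gen A) \<circ> \<theta> m (free_gen C) \<circ> \<theta> m (free_gen A)"
      using gen by (simp add: hom_mult[OF hom] Q_def mult_BijGroup_UNIV bij bij_comp)
    then show ?thesis
      by (simp add: q_def \<theta>_Suc lysenok_sigma_gen F_def)
  qed
  have q_0: "q 0 = (perm_a, perm_b, perm_c, perm_d)"
    by (simp add: q_def \<theta>_0 Q.free_lift_gen[OF range_perm])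
  \<comment> \<open>These seven states contain the initial one and are closed under the update; the
    last returns to the fifth.\<close>
  have "q m \<in> {(perm_a, perm_b, perm_c, perm_d), (perm_x1, perm_d, perm_b, perm_c),
      (perm_x2, perm_c, perm_d, perm_b), (flip {7}, perm_b, perm_c, perm_d),
      (perm_c, perm_d, perm_b, perm_c), (perm_b, perm_c, perm_d, perm_b),
      (perm_d, perm_b, perm_c, perm_d)}" for m
  proof (induction m)
    case 0
    show ?case by (simp add: q_0)
  next
    case (Suc m)
    then show ?case unfolding q_Suc
      by (elim insertE emptyE) (simp_all add: perm_recursion perm_x1_def[symmetric] perm_x2_def[symmetric])
  qed
  then have "relators_hold (q m)" for m
    using relators_hold_states by (metis empty_iff insert_iff)
  then have rel: "(\<theta> m (free_gen A) \<circ> \<theta> m (free_gen D)) ^^ 4 = id"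
    "(\<theta> m (free_gen A) \<circ> \<theta> m (free_gen D) \<circ> \<theta> m (free_gen A) \<circ> \<theta> m (free_gen C)
      \<circ> \<theta> m (free_gen A) \<circ> \<theta> m (free_gen C)) ^^ 4 = id" for m
    by (simp_all add: relators_hold_def q_def)
  interpret h: group_hom F Q h
    using hom[of n] by unfold_locales (simp add: h_def \<theta>_def[abs_def])
  have h: "h = \<theta> n" by (simp add: h_def \<theta>_def fun_eq_iff)
  have hbij: "bij (h (free_gen x))" for x using bij by (simp add: h)
  show "h ((free_gen A \<otimes>\<^bsub>F\<^esub> free_gen D) [^]\<^bsub>F\<^esub> (4::nat)) = \<one>\<^bsub>Q\<^esub>"
    using rel(1)[of n] gen
    by (simp add: h.hom_nat_pow h[symmetric] Q_def mult_BijGroup_UNIV pow_BijGroup_UNIV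
        one_BijGroup_UNIV hbij bij_comp)
  show "h ((free_gen A \<otimes>\<^bsub>F\<^esub> free_gen D \<otimes>\<^bsub>F\<^esub> free_gen A \<otimes>\<^bsub>F\<^esub> free_gen C
           \<otimes>\<^bsub>F\<^esub> free_gen A \<otimes>\<^bsub>F\<^esub> free_gen C) [^]\<^bsub>F\<^esub> (4::nat)) = \<one>\<^bsub>Q\<^esub>"
    using rel(2)[of n] gen
    by (simp add: h.hom_nat_pow h[symmetric] Q_def mult_BijGroup_UNIV pow_BijGroup_UNIV
        one_BijGroup_UNIV hbij bij_comp)
qed

section \<open>The Grigorchuk group\<close>

text \<open>The five finite relators hold by \<open>perm_invol\<close>, the two families by the
  orbit argument, so the action descends to the presented group.\<close>

lemma grigorchuk_perm_hom:
  obtains h where "h \<in> hom grigorchuk_group (BijGroup UNIV)"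
    "\<And>x. h (grigorchuk_gen x) = perm x"
proof -
  let ?Q = "BijGroup (UNIV :: (nat \<times> bool) set)"
  have range_perm: "range perm \<subseteq> carrier ?Q"
    by (auto simp: carrier_BijGroup_UNIV bij_letter_perm)
  interpret Q: group ?Q by (rule group_BijGroup)
  interpret l: group_hom free_group ?Q "free_lift ?Q perm"
    by (intro group_hom.intro group_hom_axioms.intro group_free_group group_BijGroup
        Q.free_lift_hom range_perm)
  have "free_lift ?Q perm r = \<one>\<^bsub>?Q\<^esub>" if "r \<in> grigorchuk_relators" for r
    using that perm_sigma_relators perm_invol
    unfolding grigorchuk_relators_def Let_def
    by (auto simp: free_gen_closed l.hom_nat_pow Q.free_lift_gen[OF range_perm] bij_perm
        mult_BijGroup_UNIV one_BijGroup_UNIV pow_BijGroup_UNIV bij_comp numeral_2_eq_2)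
  then show thesis
    using that presented_group_lift[OF group_BijGroup grigorchuk_relators_closed range_perm]
    unfolding grigorchuk_group_def grigorchuk_gen_def by blast
qed

lemma grigorchuk_relations:
  fixes G (structure) and a b c d :: "letter word set set"
  defines "G \<equiv> grigorchuk_group"
    and "a \<equiv> grigorchuk_gen A" and "b \<equiv> grigorchuk_gen B"
    and "c \<equiv> grigorchuk_gen C" and "d \<equiv> grigorchuk_gen D"
  shows "a \<otimes> a = \<one>" "b \<otimes> b = \<one>" "c \<otimes> c = \<one>" "d \<otimes> d = \<one>" "b \<otimes> c \<otimes> d = \<one>"
    "(a \<otimes> c) [^] (8::nat) = \<one>"
proof -
  let ?F = "free_group :: letter word set monoid"
  let ?p = "\<lambda>x. normal_closure ?F grigorchuk_relators #>\<^bsub>?F\<^esub> x"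
  interpret F: group ?F by (rule group_free_group)
  interpret p: group_hom ?F G ?p
    unfolding G_def grigorchuk_group_def
    by (intro group_hom.intro group_hom_axioms.intro group_free_group
        group_presented_group presented_projection_hom grigorchuk_relators_closed)
  interpret sigma: group_hom ?F ?F lysenok_sigma
    by unfold_locales (rule lysenok_sigma_hom)
  have rel: "?p r = \<one>" if "r \<in> grigorchuk_relators" for r
    using presented_projection_relator[OF grigorchuk_relators_closed that]
    by (simp add: G_def grigorchuk_group_def)
  have gen: "?p (free_gen x) = grigorchuk_gen x" for x
    by (simp add: grigorchuk_gen_def presented_gen_def)
  have pow2: "grigorchuk_gen x \<otimes> grigorchuk_gen x = \<one>"
    if "free_gen x [^]\<^bsub>?F\<^esub> (2::nat) \<in> grigorchuk_relators" for x
    using rel[OF that] by (simp add: free_gen_closed numeral_2_eq_2 gen[symmetric])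
  show aa: "a \<otimes> a = \<one>" and "b \<otimes> b = \<one>" "c \<otimes> c = \<one>" "d \<otimes> d = \<one>"
    unfolding a_def b_def c_def d_def
    by (rule pow2; simp add: grigorchuk_relators_def Let_def)+
  have "?p (free_gen B \<otimes>\<^bsub>?F\<^esub> free_gen C \<otimes>\<^bsub>?F\<^esub> free_gen D) = \<one>"
    by (rule rel) (simp add: grigorchuk_relators_def Let_def)
  then show "b \<otimes> c \<otimes> d = \<one>"
    by (simp add: free_gen_closed gen b_def c_def d_def)
  have ac: "a \<in> carrier G" "c \<in> carrier G"
    using p.hom_closed[OF free_gen_closed[of A]] p.hom_closed[OF free_gen_closed[of C]]
    by (simp_all add: gen a_def c_def)
  have "(lysenok_sigma ^^ 1) ((free_gen A \<otimes>\<^bsub>?F\<^esub> free_gen D) [^]\<^bsub>?F\<^esub> (4::nat)) \<in> grigorchuk_relators"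
    unfolding grigorchuk_relators_def Let_def by blast
  from rel[OF this] have "(a \<otimes> c \<otimes> a \<otimes> c) [^] (4::nat) = \<one>"
    by (simp add: sigma.hom_nat_pow p.hom_nat_pow lysenok_sigma_gen free_gen_closed gen a_def c_def)
  moreover have "a \<otimes> c \<otimes> a \<otimes> c = (a \<otimes> c) [^] (2::nat)"
    using ac by (simp add: numeral_2_eq_2 p.H.m_assoc)
  ultimately have "(a \<otimes> c) [^] (2 * 4 :: nat) = \<one>"
    using ac by (simp only: p.H.nat_pow_pow p.H.m_closed)
  then show "(a \<otimes> c) [^] (8::nat) = \<one>" by simp
qed

lemma (in group) generate_insert_redundant:
  assumes "S \<subseteq> carrier G" "x \<in> generate G S"
  shows "generate G (insert x S) = generate G S"
proof
  show "generate G (insert x S) \<subseteq> generate G S"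
    using assms by (intro generate_subgroup_incl generate_is_subgroup) (auto intro: generate.incl)
  show "generate G S \<subseteq> generate G (insert x S)" by (rule mono_generate) auto
qed

lemma normal_closure_grigorchuk_d:
  fixes G (structure) and a c d :: "letter word set set"
  defines "G \<equiv> grigorchuk_group"
    and "a \<equiv> grigorchuk_gen A" and "c \<equiv> grigorchuk_gen C" and "d \<equiv> grigorchuk_gen D"
  shows "normal_closure G {d} = generate G ((\<lambda>k. conjugate G d (group.alternating G a c k)) ` {..<8})"
proof -
  define b where "b = grigorchuk_gen B"
  interpret group G unfolding G_def by (rule group_grigorchuk_group)
  have carrier: "grigorchuk_gen x \<in> carrier G" for x
    unfolding G_def grigorchuk_group_def grigorchuk_gen_def
    by (rule presented_gen_closed[OF grigorchuk_relators_closed])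
  note closed = carrier[of A, folded a_def] carrier[of B, folded b_def]
    carrier[of C, folded c_def] carrier[of D, folded d_def]
  note rel = grigorchuk_relations[folded G_def, folded a_def b_def c_def d_def]
  have b: "b = c \<otimes> d"
  proof -
    have "b = b \<otimes> (b \<otimes> c \<otimes> d)" using rel(5) closed by simp
    also have "\<dots> = b \<otimes> b \<otimes> (c \<otimes> d)" using closed by (simp only: m_assoc m_closed)
    finally show ?thesis using rel(2) closed by simp
  qed
  have comm: "c \<otimes> d = d \<otimes> c"
  proof -
    have "inv b = b" "inv c = c" "inv d = d"
      using rel closed by (simp_all only: inv_equality)
    then show ?thesis using inv_mult_group[of c d] closed by (simp add: b)
  qed
  have "carrier G = generate G (range grigorchuk_gen)"
    unfolding G_def grigorchuk_group_def grigorchuk_gen_def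
    by (rule carrier_presented_group[OF grigorchuk_relators_closed])
  also have "range grigorchuk_gen = insert b {a, c, d}"
  proof -
    have "(UNIV :: letter set) = {B, A, C, D}" using letter.exhaust by auto
    then have "range grigorchuk_gen = grigorchuk_gen ` {B, A, C, D}" by (rule arg_cong)
    then show ?thesis by (simp only: image_insert image_empty a_def b_def c_def d_def)
  qed
  also have "generate G (insert b {a, c, d}) = generate G {a, c, d}"
    unfolding b using closed
    by (intro generate_insert_redundant generate.eng generate.incl) auto
  finally show ?thesis
    using closed rel comm by (intro normal_closure_eq_generate_conjugates)
qed

section \<open>The rank of the group of sign changes\<close>

lemma flips_subset_generate:
  "flip ` Pow {..<n} \<subseteq> generate (BijGroup UNIV) ((\<lambda>k. flip {k}) ` {..<n})"
proof
  fix f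
  assume "f \<in> flip ` Pow {..<n}"
  then obtain Z where Z: "f = flip Z" "Z \<subseteq> {..<n}" by auto
  have "finite Z" using Z(2) by (rule finite_subset) simp
  then have "flip Z \<in> generate (BijGroup UNIV) ((\<lambda>k. flip {k}) ` {..<n})"
    using Z(2)
  proof (induction Z)
    case empty
    show ?case
      using generate.one[of "BijGroup (UNIV :: (nat \<times> bool) set)"]
      by (simp only: flip_empty one_BijGroup_UNIV)
  next
    case (insert k Z)
    have "sym_diff {k} Z = insert k Z" using insert.hyps by auto
    then have "flip (insert k Z) = flip {k} \<otimes>\<^bsub>BijGroup UNIV\<^esub> flip Z"
      by (simp add: mult_BijGroup_UNIV bij_flip flip_comp)
    with insert show ?case by (auto intro!: generate.eng intro: generate.incl)
  qed
  then show "f \<in> generate (BijGroup UNIV) ((\<lambda>k. flip {k}) ` {..<n})" by (simp add: Z)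
qed

text \<open>A count: the sign changes in \<open>S\<close> commute and square to one, so they
  generate at most \<open>2 ^ card S\<close> elements, among which must be the \<open>2 ^ n\<close>
  sign changes of subsets of the first \<open>n\<close> points.\<close>

lemma card_generating_set_flips:
  assumes S: "finite S" "S \<subseteq> range flip"
    and gen: "(\<lambda>k. flip {k}) ` {..<n} \<subseteq> generate (BijGroup UNIV) S"
  shows "n \<le> card S"
proof -
  let ?Q = "BijGroup (UNIV :: (nat \<times> bool) set)"
  interpret group ?Q by (rule group_BijGroup)
  have flip: "range flip \<subseteq> carrier ?Q" by (auto simp: carrier_BijGroup_UNIV bij_flip)
  have "finite (generate ?Q S) \<and> card (generate ?Q S) \<le> 2 ^ card S"
  proof (rule card_generate_commuting_involutions)
    show "x \<otimes>\<^bsub>?Q\<^esub> x = \<one>\<^bsub>?Q\<^esub>" if "x \<in> S" for x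
      using that S by (auto simp: mult_BijGroup_UNIV one_BijGroup_UNIV bij_flip flip_comp flip_empty)
    show "x \<otimes>\<^bsub>?Q\<^esub> y = y \<otimes>\<^bsub>?Q\<^esub> x" if xy: "x \<in> S" "y \<in> S" for x y
    proof -
      obtain Z Z' where "x = flip Z" "y = flip Z'" using xy S(2) by blast
      then show ?thesis by (simp add: mult_BijGroup_UNIV bij_flip flip_comp Un_commute)
    qed
  qed (use S flip in auto)
  moreover have "flip ` Pow {..<n} \<subseteq> generate ?Q S"
    using flips_subset_generate[of n] gen S flip
    by (meson dual_order.trans generate_is_subgroup generate_subgroup_incl)
  then have "card (flip ` Pow {..<n}) \<le> card (generate ?Q S)"
    using calculation by (intro card_mono) auto
  moreover have "card (flip ` Pow {..<n}) = 2 ^ n"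
    using inj_flip by (simp add: card_image inj_on_subset card_Pow)
  ultimately have "(2::nat) ^ n \<le> 2 ^ card S" by linarith
  then show ?thesis by simp
qed

theorem mainTheorem5:
  fixes G (structure) and a c d :: "letter word set set"
  defines "G \<equiv> grigorchuk_group"
    and "a \<equiv> grigorchuk_gen A"
    and "c \<equiv> grigorchuk_gen C" and "d \<equiv> grigorchuk_gen D"
  shows "normal_closure G {d} =
      generate G {d, conjugate G d a, conjugate G d (a \<otimes> c), conjugate G d (a \<otimes> c \<otimes> a),
        conjugate G d (a \<otimes> c \<otimes> a \<otimes> c), conjugate G d (a \<otimes> c \<otimes> a \<otimes> c \<otimes> a),
        conjugate G d (a \<otimes> c \<otimes> a \<otimes> c \<otimes> a \<otimes> c),
        conjugate G d (a \<otimes> c \<otimes> a \<otimes> c \<otimes> a \<otimes> c \<otimes> a)}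
    \<and> (\<forall>S. S \<subseteq> normal_closure G {d} \<and> generate G S = normal_closure G {d} \<longrightarrow>
         \<not> (finite S \<and> card S < 8))
    \<and> normal_closure G {d} \<noteq>
        generate G {d, conjugate G d a, conjugate G d (a \<otimes> c), conjugate G d (a \<otimes> c \<otimes> a)}"
proof -
  let ?Q = "BijGroup (UNIV :: (nat \<times> bool) set)"
  interpret group G unfolding G_def by (rule group_grigorchuk_group)
  have carrier: "grigorchuk_gen x \<in> carrier G" for x
    unfolding G_def grigorchuk_group_def grigorchuk_gen_def
    by (rule presented_gen_closed[OF grigorchuk_relators_closed])
  note closed = carrier[of A, folded a_def] carrier[of C, folded c_def] carrier[of D, folded d_def]
  let ?x = "\<lambda>k. conjugate G d (alternating a c k)"
  have N: "normal_closure G {d} = generate G (?x ` {..<8})"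
    using normal_closure_grigorchuk_d by (simp only: G_def a_def c_def d_def)
  have X: "?x ` {..<8} \<subseteq> carrier G" using closed by auto
  have "{..<8} = {0, 1, 2, 3, 4, 5, 6, 7::nat}" by auto
  moreover have "alternating a c 2 = a \<otimes> c" using closed by (simp add: numeral_2_eq_2)
  ultimately have X_eq: "?x ` {..<8} = {d, conjugate G d a, conjugate G d (a \<otimes> c), conjugate G d (a \<otimes> c \<otimes> a),
        conjugate G d (a \<otimes> c \<otimes> a \<otimes> c), conjugate G d (a \<otimes> c \<otimes> a \<otimes> c \<otimes> a),
        conjugate G d (a \<otimes> c \<otimes> a \<otimes> c \<otimes> a \<otimes> c),
        conjugate G d (a \<otimes> c \<otimes> a \<otimes> c \<otimes> a \<otimes> c \<otimes> a)}"
    using alternating.simps(2)[of a c 2] alternating.simps(2)[of a c 3]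
      alternating.simps(2)[of a c 4] alternating.simps(2)[of a c 5] alternating.simps(2)[of a c 6] closed
    by (simp add: conjugate_def[of G d \<one>])
  obtain h where h: "h \<in> hom G ?Q" "\<And>x. h (grigorchuk_gen x) = perm x"
    using grigorchuk_perm_hom unfolding G_def by blast
  interpret h: group_hom G ?Q h
    by (intro group_hom.intro group_hom_axioms.intro group_BijGroup h is_group)
  have h_conj: "h (conjugate G x y) = h y \<circ> h x \<circ> h y"
    if "x \<in> carrier G" "y \<in> carrier G" "h y \<circ> h y = id" for x y
  proof -
    have bij: "bij (h z)" if "z \<in> carrier G" for z
      using h.hom_closed[OF that] by (simp add: carrier_BijGroup_UNIV)
    have "inv\<^bsub>?Q\<^esub> h y = h y"
      using that h.hom_closed
      by (intro h.H.inv_equality) (auto simp: mult_BijGroup_UNIV one_BijGroup_UNIV bij)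
    then show ?thesis
      using that by (simp add: conjugate_def mult_BijGroup_UNIV bij bij_comp)
  qed
  \<comment> \<open>The induction walks along the path from \<open>perm_d = flip {0}\<close>: the
    next letter is \<open>a\<close> at even and \<open>c\<close> at odd \<open>k\<close>, and the
    corresponding matching carries \<open>k\<close> to \<open>Suc k\<close>.\<close>
  have hx: "h (?x k) = flip {k}" if "k < 8" for k
    using that
  proof (induction k)
    case 0
    show ?case using closed h(2)[of D] by (simp add: conjugate_def d_def perm_d_def)
  next
    case (Suc k)
    let ?y = "if even k then a else c"
    have hy: "h ?y = map_prod (if even k then swap_even else swap_odd) id"
      using h(2) by (simp add: a_def c_def perm_a_def perm_c_def)
    have "h (?x (Suc k)) = h (conjugate G (?x k) ?y)"
      using closed by (simp add: conjugate_conjugate)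
    also have "\<dots> = h ?y \<circ> h (?x k) \<circ> h ?y"
      by (rule h_conj) (use closed in \<open>auto simp: hy fun_eq_iff swap_even_invol swap_odd_invol\<close>)
    also have "\<dots> = flip {Suc k}"
      unfolding hy Suc.IH[OF Suc_lessD[OF Suc.prems]]
      by (rule flip_conjugate)
        (use Suc.prems in \<open>auto simp: swap_even_invol swap_odd_invol swap_even_def swap_odd_def elim: oddE\<close>)
    finally show ?case .
  qed
  have h_N: "h ` normal_closure G {d} = generate ?Q ((\<lambda>k. flip {k}) ` {..<8})"
    unfolding N by (subst h.generate_img[OF X, symmetric]) (simp add: image_image hx cong: image_cong_simp)
  \<comment> \<open>An arbitrary generating set need not consist of conjugates of \<open>d\<close>;
    this ensures that its image still consists of commuting involutions.\<close>
  have h_flip: "h ` normal_closure G {d} \<subseteq> range flip"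
  proof -
    have "x \<in> range flip" if "x \<in> generate ?Q ((\<lambda>k. flip {k}) ` {..<8})" for x
      using that
    proof (induction rule: generate.induct)
      case one
      show ?case by (simp add: one_BijGroup_UNIV flip_empty[symmetric])
    next
      case (incl x)
      then show ?case by auto
    next
      case (inv x)
      then obtain k where "x = flip {k}" by auto
      then have "inv\<^bsub>?Q\<^esub> x = flip {k}"
        by (intro h.H.inv_equality)
          (auto simp: mult_BijGroup_UNIV one_BijGroup_UNIV carrier_BijGroup_UNIV bij_flip flip_comp flip_empty)
      then show ?case by simp
    next
      case (eng x y)
      then show ?case by (auto simp: mult_BijGroup_UNIV bij_flip flip_comp)
    qed
    then show ?thesis unfolding h_N by blast
  qed
  have lower: "8 \<le> card S"
    if S: "S \<subseteq> normal_closure G {d}" "generate G S = normal_closure G {d}" "finite S" for S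
  proof -
    \<comment> \<open>The bound is pulled back along \<open>h\<close>: the image of \<open>S\<close>
      generates the image of the normal closure and has no more elements than
      \<open>S\<close>.\<close>
    have "S \<subseteq> carrier G" using S(1) generate_incl[OF X] unfolding N by blast
    then have "generate ?Q (h ` S) = h ` normal_closure G {d}"
      using h.generate_img S(2) by metis
    then have "(\<lambda>k. flip {k}) ` {..<8} \<subseteq> generate ?Q (h ` S)"
      unfolding h_N by (auto intro: generate.incl)
    moreover have "h ` S \<subseteq> range flip" using S(1) h_flip by blast
    ultimately have "8 \<le> card (h ` S)"
      using S(3) by (intro card_generating_set_flips) auto
    also have "\<dots> \<le> card S" by (rule card_image_le[OF S(3)])
    finally show ?thesis .
  qed
  let ?Y = "{d, conjugate G d a, conjugate G d (a \<otimes> c), conjugate G d (a \<otimes> c \<otimes> a)}"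
  have "?Y \<subseteq> normal_closure G {d}"
    unfolding N X_eq by (auto intro: generate.incl)
  \<comment> \<open>An upper bound suffices, so the four conjugates need not be shown
    distinct.\<close>
  moreover have "card ?Y \<le> 4" by (simp add: card_insert_if)
  ultimately have "normal_closure G {d} \<noteq> generate G ?Y"
    using lower[of ?Y] by auto
  moreover have "\<not> (finite S \<and> card S < 8)"
    if "S \<subseteq> normal_closure G {d} \<and> generate G S = normal_closure G {d}" for S
    using lower[of S] that by linarith
  ultimately show ?thesis using N unfolding X_eq by blast
qed

end
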